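(* Let $D$ be a cross-shaped grid and $L$ any proper labeling of its rows and columns. Then the framing lattice $\mathscr L_{G_{D,L},F_{D,L}}$ is isomorphic to the cross-Tamari order $\mathrm{Tam}(D)$.
   Context: A flow graph $G$ is a finite directed acyclic multigraph with linearly ordered vertices, edges directed from smaller to larger vertices, a unique source $s$ and unique sink $t$; a route is a directed $s$–$t$ path. A framing $F$ gives at each vertex $v$ linear orders $\le_{\mathrm{In}(v)}$, $\le_{\mathrm{Out}(v)}$ on entering and leaving edges. For a path $P$ through $v$, $Pv$ (resp. $vP$) is the maximal subpath of $P$ ending (resp. starting) at $v$. For $Pv,Qv$, let $w$ be the first vertex after which they coincide; if $w$ is the first vertex of one of them they are equal, else $Pv<_{\mathscr I(v)}Qv$ iff $P$'s edge entering $w$ precedes $Q$'s in $\le_{\mathrm{In}(w)}$. Dually for $vP,vQ$ with $w'$ the last vertex before which they coincide, using $\le_{\mathrm{Out}(w')}$, giving $<_{\mathscr O(v)}$. For paths $P,Q$ with common inner vertex $v$, $P<_v^{cw}Q$ means $Pv<_{\mathscr I(v)}Qv$ and $vQ<_{\mathscr O(v)}vP$; they are incoherent at $v$ if $P<_v^{cw}Q$ or $Q<_v^{cw}P$, coherent if incoherent at no common inner vertex. A clique is a set of pairwise coherent routes. For maximal cliques, $C\lessdot C'$ if $C'=(C\setminus\{R\})\cup\{R'\}$ with $R<_u^{cw}R'$ for some $u$; the framing lattice $\mathscr L_{G,F}$ is the set of maximal cliques with the reflexive-transitive closure of $\lessdot$. A finite nonempty set $D\subseteq\mathbb Z^2$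 is a cross-shaped grid if it is horizontally connected (if $(x,y),(x',y)\in D$ then $(z,y)\in D$ for all $x<z<x'$), vertically connected (analogously), horizontally nested (if row $y$ of $D$ has at most as many points as row $y'$, then the $x$-coordinates of the points of row $y$ are a subset of those of row $y'$) and vertically nested (analogously for columns). Let $D$ have $a$ columns and $b$ rows; $\ell(\cdot)$ denotes the number of points of $D$ in a column or row. A proper labeling $L$ labels the columns bijectively by $1,\dots,a$ and the rows by $\bar1,\dots,\bar b$ so that column $1$ is a longest column, for each $k$ the columns labeled $1,\dots,k$ form a contiguous block (so labels read left to right first decrease, then increase), and $\ell(v)>\ell(v')$ implies $v<v'$; and analogously for rows (row $\bar1$ longest, rows $\bar1,\dots,\bar k$ contiguous, $\ell(\bar w)>\ell(\bar w')$ implies $w<w'$). A point of $D$ in column $v$ and row $\bar w$ is written $(v,\bar w)$. The $(D,L)$-caracol graph $G_{D,L}$ has vertex set $\{s,t\}\sqcup[a]\sqcup\{\bar1,\dots,\bar b\}$, linearly ordered by $\prec$ with $s$ minimal, $t$ maximal, $i_1\prec i_2$ iff $i_1<i_2$, $\bar j_2\prec\bar j_1$ iff $j_1<j_2$, and $x\prec\bar y$ iff $(x,\bar y)\in D$. Place the vertices on a horizontal line in the order $\prec$ and draw an edge between each pair of consecutive vertices; additionally, for each column label $i\ne1$ draw an edge $(s,i)$, as an arc above the line if column $i$ is to the left of column $1$ and below if to the right; for each row label $\bar j\ne\bar1$ draw an edge $(\bar j,t)$, above the line if row $\bar j$ is above row $\bar1$ and below otherwise (arcs on one side nested without crossings).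 $F_{D,L}$ is the framing induced by this drawing: at each vertex, incoming edges and outgoing edges are each ordered from top to bottom. Two distinct points $p,p'\in D$ are incompatible if one is strictly north-east of the other and every lattice point of the smallest axis-parallel rectangle containing them lies in $D$; otherwise compatible. A maximal filling is a maximal set of pairwise compatible points of $D$. If maximal fillings satisfy $T\setminus\{p\}=T'\setminus\{p'\}$ with $p'$ strictly north-east of $p$, $T'$ is obtained from $T$ by an increasing rotation. $\mathrm{Tam}(D)$ is the poset of maximal fillings with $T\preceq T'$ iff $T'$ is obtained from $T$ by a sequence of increasing rotations. *)

theory Defs
  imports "Graph_Theory.Arc_Walk"
begin

section \<open>Framed flow graphs and the framing lattice\<close>

text \<open>Arcs have their own type, so parallel edges are allowed. The linear orders on the vertices
  and on the arcs at a vertex are reflexive relations: \<open>(e, f) \<in> In v\<close> means that \<open>e\<close> precedes or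
  equals \<open>f\<close> in the order on the arcs entering \<open>v\<close>.\<close>

locale flow_graph = fin_digraph G for G :: "('a, 'b) pre_digraph" +
  fixes vord :: "'a rel" and s t :: 'a
  assumes vord: "linear_order_on (verts G) vord"
    and arcs_increasing: "e \<in> arcs G \<Longrightarrow> tail G e \<noteq> head G e \<and> (tail G e, head G e) \<in> vord"
    and s_in_verts: "s \<in> verts G"
    and t_in_verts: "t \<in> verts G"
    and source_iff: "v \<in> verts G \<Longrightarrow> in_arcs G v = {} \<longleftrightarrow> v = s"
    and sink_iff: "v \<in> verts G \<Longrightarrow> out_arcs G v = {} \<longleftrightarrow> v = t"

locale framed_flow_graph = flow_graph +
  fixes In Out :: "'a \<Rightarrow> 'b rel"
  assumes In: "v \<in> verts G \<Longrightarrow> linear_order_on (in_arcs G v) (In v)"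
    and Out: "v \<in> verts G \<Longrightarrow> linear_order_on (out_arcs G v) (Out v)"
begin

text \<open>Paths are lists of arcs. No vertex is visited twice, since the graph is acyclic.\<close>

definition routes :: "'b awalk set" where
  "routes = {P. awalk s P t}"

definition inner_verts :: "'b awalk \<Rightarrow> 'a set" where
  "inner_verts P = head G ` set (butlast P)"

text \<open>The subpaths \<open>Pv\<close> and \<open>vP\<close> of a path \<open>P\<close> through \<open>v\<close>.\<close>

definition path_upto :: "'b awalk \<Rightarrow> 'a \<Rightarrow> 'b awalk" where
  "path_upto P v = takeWhile (\<lambda>e. tail G e \<noteq> v) P"

definition path_from :: "'a \<Rightarrow> 'b awalk \<Rightarrow> 'b awalk" where
  "path_from v P = dropWhile (\<lambda>e. tail G e \<noteq> v) P"

text \<open>\<open>R\<close> is the longest common final segment of \<open>Pv\<close> and \<open>Qv\<close>; the vertex \<open>w\<close> at which it starts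
  is \<open>head G e = head G f\<close>. If \<open>w\<close> is the first vertex of \<open>Pv\<close> or \<open>Qv\<close>, there is no such
  decomposition and neither precedes the other. The relation on the outgoing side is dual.\<close>

definition in_less :: "'a \<Rightarrow> 'b awalk \<Rightarrow> 'b awalk \<Rightarrow> bool" where
  "in_less v P Q \<longleftrightarrow> (\<exists>A B e f R.
     path_upto P v = A @ e # R \<and> path_upto Q v = B @ f # R \<and> e \<noteq> f \<and> (e, f) \<in> In (head G e))"

definition out_less :: "'a \<Rightarrow> 'b awalk \<Rightarrow> 'b awalk \<Rightarrow> bool" where
  "out_less v P Q \<longleftrightarrow> (\<exists>A B e f R.
     path_from v P = R @ e # A \<and> path_from v Q = R @ f # B \<and> e \<noteq> f \<and> (e, f) \<in> Out (tail G e))"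

definition cw_less :: "'a \<Rightarrow> 'b awalk \<Rightarrow> 'b awalk \<Rightarrow> bool" where
  "cw_less v P Q \<longleftrightarrow>
     v \<in> inner_verts P \<inter> inner_verts Q \<and> in_less v P Q \<and> out_less v Q P"

definition incoherent_at :: "'a \<Rightarrow> 'b awalk \<Rightarrow> 'b awalk \<Rightarrow> bool" where
  "incoherent_at v P Q \<longleftrightarrow> cw_less v P Q \<or> cw_less v Q P"

definition coherent :: "'b awalk \<Rightarrow> 'b awalk \<Rightarrow> bool" where
  "coherent P Q \<longleftrightarrow> (\<forall>v \<in> inner_verts P \<inter> inner_verts Q. \<not> incoherent_at v P Q)"

definition clique :: "'b awalk set \<Rightarrow> bool" where
  "clique C \<longleftrightarrow> C \<subseteq> routes \<and> pairwise coherent C"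

definition maximal_cliques :: "'b awalk set set" where
  "maximal_cliques = {C. clique C \<and> (\<forall>C'. clique C' \<and> C \<subseteq> C' \<longrightarrow> C' = C)}"

definition clique_step :: "'b awalk set rel" where
  "clique_step = {(C, C'). C \<in> maximal_cliques \<and> C' \<in> maximal_cliques \<and>
     (\<exists>R\<in>C. \<exists>R' u. C' = insert R' (C - {R}) \<and> cw_less u R R')}"

text \<open>Reflexive on the maximal cliques, so \<open>Field framing_lattice = maximal_cliques\<close>. The same holds for
  \<open>Tam\<close> below; hence \<open>iso\<close> between the two means a bijection of the carriers that preserves and
  reflects the order, see \<open>iso_iff2\<close>.\<close>

definition framing_lattice :: "'b awalk set rel" where
  "framing_lattice = {(C, C'). C \<in> maximal_cliques \<and> C' \<in> maximal_cliques \<and> (C, C') \<in> clique_step\<^sup>*}"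

end


section \<open>Cross-shaped grids and proper labelings\<close>

type_synonym point = "int \<times> int"

definition columns :: "point set \<Rightarrow> int set" where
  "columns D = fst ` D"

definition rows :: "point set \<Rightarrow> int set" where
  "rows D = snd ` D"

text \<open>The points of a row are given by their \<open>x\<close>-coordinates, those of a column by their
  \<open>y\<close>-coordinates.\<close>

definition row :: "point set \<Rightarrow> int \<Rightarrow> int set" where
  "row D y = {x. (x, y) \<in> D}"

definition column :: "point set \<Rightarrow> int \<Rightarrow> int set" where
  "column D x = {y. (x, y) \<in> D}"

definition horizontally_connected :: "point set \<Rightarrow> bool" where
  "horizontally_connected D \<longleftrightarrow>
     (\<forall>x x' y z. (x, y) \<in> D \<and> (x', y) \<in> D \<and> x < z \<and> z < x' \<longrightarrow> (z, y) \<in> D)"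

definition vertically_connected :: "point set \<Rightarrow> bool" where
  "vertically_connected D \<longleftrightarrow>
     (\<forall>x y y' z. (x, y) \<in> D \<and> (x, y') \<in> D \<and> y < z \<and> z < y' \<longrightarrow> (x, z) \<in> D)"

definition horizontally_nested :: "point set \<Rightarrow> bool" where
  "horizontally_nested D \<longleftrightarrow>
     (\<forall>y\<in>rows D. \<forall>y'\<in>rows D. card (row D y) \<le> card (row D y') \<longrightarrow> row D y \<subseteq> row D y')"

definition vertically_nested :: "point set \<Rightarrow> bool" where
  "vertically_nested D \<longleftrightarrow>
     (\<forall>x\<in>columns D. \<forall>x'\<in>columns D. card (column D x) \<le> card (column D x') \<longrightarrow>
        column D x \<subseteq> column D x')"

definition cross_shaped_grid :: "point set \<Rightarrow> bool" where
  "cross_shaped_grid D \<longleftrightarrow> finite D \<and> D \<noteq> {} \<and>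
     horizontally_connected D \<and> vertically_connected D \<and>
     horizontally_nested D \<and> vertically_nested D"

text \<open>A labeling maps the coordinate of a column or row to its label; only the values on
  \<open>columns D\<close> and \<open>rows D\<close> matter. The bar on row labels is supplied by the constructor \<open>Row\<close> below.\<close>

record grid_labeling =
  col_label :: "int \<Rightarrow> nat"
  row_label :: "int \<Rightarrow> nat"

definition proper_line_labeling :: "int set \<Rightarrow> (int \<Rightarrow> nat) \<Rightarrow> (int \<Rightarrow> nat) \<Rightarrow> bool" where
  "proper_line_labeling S len lab \<longleftrightarrow>
     bij_betw lab S {1..card S} \<and>
     (\<forall>x\<in>S. lab x = 1 \<longrightarrow> (\<forall>x'\<in>S. len x' \<le> len x)) \<and>
     (\<forall>k\<in>{1..card S}. \<exists>l r. {x \<in> S. lab x \<le> k} = {l..r}) \<and>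
     (\<forall>x\<in>S. \<forall>x'\<in>S. len x > len x' \<longrightarrow> lab x < lab x')"

definition proper_labeling :: "point set \<Rightarrow> grid_labeling \<Rightarrow> bool" where
  "proper_labeling D L \<longleftrightarrow>
     proper_line_labeling (columns D) (\<lambda>x. card (column D x)) (col_label L) \<and>
     proper_line_labeling (rows D) (\<lambda>y. card (row D y)) (row_label L)"

definition col_pos :: "point set \<Rightarrow> grid_labeling \<Rightarrow> nat \<Rightarrow> int" where
  "col_pos D L i = inv_into (columns D) (col_label L) i"

definition row_pos :: "point set \<Rightarrow> grid_labeling \<Rightarrow> nat \<Rightarrow> int" where
  "row_pos D L j = inv_into (rows D) (row_label L) j"

definition labeled_point :: "point set \<Rightarrow> grid_labeling \<Rightarrow> nat \<Rightarrow> nat \<Rightarrow> point" where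
  "labeled_point D L i j = (col_pos D L i, row_pos D L j)"


section \<open>The caracol graph of a labeled grid and its framing\<close>

datatype vertex = Source | Sink | Col nat | Row nat

fun vless :: "point set \<Rightarrow> grid_labeling \<Rightarrow> vertex \<Rightarrow> vertex \<Rightarrow> bool" where
  "vless D L v Source \<longleftrightarrow> False"
| "vless D L Source v \<longleftrightarrow> True"
| "vless D L Sink v \<longleftrightarrow> False"
| "vless D L v Sink \<longleftrightarrow> True"
| "vless D L (Col i) (Col i') \<longleftrightarrow> i < i'"
| "vless D L (Row j') (Row j) \<longleftrightarrow> j < j'"
| "vless D L (Col i) (Row j) \<longleftrightarrow> labeled_point D L i j \<in> D"
| "vless D L (Row j) (Col i) \<longleftrightarrow> labeled_point D L i j \<notin> D"

definition caracol_verts :: "point set \<Rightarrow> vertex set" where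
  "caracol_verts D =
     {Source, Sink} \<union> Col ` {1..card (columns D)} \<union> Row ` {1..card (rows D)}"

definition caracol_order :: "point set \<Rightarrow> grid_labeling \<Rightarrow> vertex rel" where
  "caracol_order D L =
     {(u, v). u \<in> caracol_verts D \<and> v \<in> caracol_verts D \<and> (u = v \<or> vless D L u v)}"

text \<open>\<open>Seg u v\<close> is a segment of the horizontal line, \<open>Arc u v\<close> is drawn above or below it.\<close>

datatype edge =
  Seg (edge_tail: vertex) (edge_head: vertex)
| Arc (edge_tail: vertex) (edge_head: vertex)

definition caracol_edges :: "point set \<Rightarrow> grid_labeling \<Rightarrow> edge set" where
  "caracol_edges D L =
     {Seg u v | u v. u \<in> caracol_verts D \<and> v \<in> caracol_verts D \<and> vless D L u v \<and>
        \<not> (\<exists>w \<in> caracol_verts D. vless D L u w \<and> vless D L w v)} \<union>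
     {Arc Source (Col i) | i. i \<in> {2..card (columns D)}} \<union>
     {Arc (Row j) Sink | j. j \<in> {2..card (rows D)}}"

definition caracol_graph :: "point set \<Rightarrow> grid_labeling \<Rightarrow> (vertex, edge) pre_digraph" where
  "caracol_graph D L =
     \<lparr>verts = caracol_verts D, arcs = caracol_edges D L, tail = edge_tail, head = edge_head\<rparr>"

text \<open>The height at which an edge is drawn near an endpoint, positive above the line and negative
  below it. Among the arcs at the source (or at the sink) on one side of the line, those with a larger
  label are longer, hence lie further from the line, because these arcs are nested. An arc from the
  source and an arc to the sink may cross, but share no endpoint, so the framing does not compare
  them.\<close>

fun height :: "point set \<Rightarrow> grid_labeling \<Rightarrow> edge \<Rightarrow> int" where
  "height D L (Arc Source (Col i)) = (if col_pos D L i < col_pos D L 1 then int i else - int i)"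
| "height D L (Arc (Row j) Sink) = (if row_pos D L 1 < row_pos D L j then int j else - int j)"
| "height D L _ = 0"

text \<open>Edges are ordered from top to bottom, so the higher edge comes first.\<close>

definition caracol_In :: "point set \<Rightarrow> grid_labeling \<Rightarrow> vertex \<Rightarrow> edge rel" where
  "caracol_In D L v =
     {(e, f). e \<in> in_arcs (caracol_graph D L) v \<and> f \<in> in_arcs (caracol_graph D L) v \<and>
        height D L f \<le> height D L e}"

definition caracol_Out :: "point set \<Rightarrow> grid_labeling \<Rightarrow> vertex \<Rightarrow> edge rel" where
  "caracol_Out D L v =
     {(e, f). e \<in> out_arcs (caracol_graph D L) v \<and> f \<in> out_arcs (caracol_graph D L) v \<and>
        height D L f \<le> height D L e}"

definition caracol_framing_lattice :: "point set \<Rightarrow> grid_labeling \<Rightarrow> edge awalk set rel" where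
  "caracol_framing_lattice D L =
     framed_flow_graph.framing_lattice (caracol_graph D L) Source Sink
       (caracol_In D L) (caracol_Out D L)"


section \<open>The cross-Tamari order\<close>

definition strictly_NE :: "point \<Rightarrow> point \<Rightarrow> bool" where
  "strictly_NE p' p \<longleftrightarrow> fst p < fst p' \<and> snd p < snd p'"

definition bounding_rectangle :: "point \<Rightarrow> point \<Rightarrow> point set" where
  "bounding_rectangle p p' =
     {min (fst p) (fst p')..max (fst p) (fst p')} \<times> {min (snd p) (snd p')..max (snd p) (snd p')}"

definition incompatible :: "point set \<Rightarrow> point \<Rightarrow> point \<Rightarrow> bool" where
  "incompatible D p p' \<longleftrightarrow>
     (strictly_NE p p' \<or> strictly_NE p' p) \<and> bounding_rectangle p p' \<subseteq> D"

definition filling :: "point set \<Rightarrow> point set \<Rightarrow> bool" where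
  "filling D T \<longleftrightarrow> T \<subseteq> D \<and> pairwise (\<lambda>p p'. \<not> incompatible D p p') T"

definition maximal_fillings :: "point set \<Rightarrow> point set set" where
  "maximal_fillings D = {T. filling D T \<and> (\<forall>T'. filling D T' \<and> T \<subseteq> T' \<longrightarrow> T' = T)}"

definition increasing_rotation :: "point set \<Rightarrow> point set rel" where
  "increasing_rotation D = {(T, T'). T \<in> maximal_fillings D \<and> T' \<in> maximal_fillings D \<and>
     (\<exists>p\<in>T. \<exists>p'\<in>T'. T - {p} = T' - {p'} \<and> strictly_NE p' p)}"

definition Tam :: "point set \<Rightarrow> point set rel" where
  "Tam D = {(T, T'). T \<in> maximal_fillings D \<and> T' \<in> maximal_fillings D \<and>
     (T, T') \<in> (increasing_rotation D)\<^sup>*}"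


section \<open>The caracol graph is a framed flow graph\<close>

context
  fixes D :: "point set" and L :: grid_labeling
  assumes D: "cross_shaped_grid D" and L: "proper_labeling D L"
begin

private definition pt :: "nat \<Rightarrow> nat \<Rightarrow> bool" where
  "pt i j \<longleftrightarrow> labeled_point D L i j \<in> D"

private lemma fin: "finite (columns D)" "finite (rows D)"
  using D by (auto simp: cross_shaped_grid_def columns_def rows_def)

private lemma colb: "bij_betw (col_label L) (columns D) {1..card (columns D)}"
  and rowb: "bij_betw (row_label L) (rows D) {1..card (rows D)}"
  using L by (auto simp: proper_labeling_def proper_line_labeling_def)

private lemma col_pos:
  assumes "i \<in> {1..card (columns D)}"
  shows "col_pos D L i \<in> columns D" "col_label L (col_pos D L i) = i"
proof -
  have "i \<in> col_label L ` columns D" using assms colb by (simp add: bij_betw_def)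
  then show "col_pos D L i \<in> columns D" "col_label L (col_pos D L i) = i"
    by (auto simp: col_pos_def inv_into_into f_inv_into_f)
qed

private lemma row_pos:
  assumes "j \<in> {1..card (rows D)}"
  shows "row_pos D L j \<in> rows D" "row_label L (row_pos D L j) = j"
proof -
  have "j \<in> row_label L ` rows D" using assms rowb by (simp add: bij_betw_def)
  then show "row_pos D L j \<in> rows D" "row_label L (row_pos D L j) = j"
    by (auto simp: row_pos_def inv_into_into f_inv_into_f)
qed

private lemma pt_mono_col:
  assumes "i \<in> {1..card (columns D)}" "i' \<in> {1..card (columns D)}" "i \<le> i'" "pt i' j"
  shows "pt i j"
proof -
  have "\<not> card (column D (col_pos D L i')) > card (column D (col_pos D L i))"
  proof
    assume "card (column D (col_pos D L i')) > card (column D (col_pos D L i))"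
    then have "col_label L (col_pos D L i') < col_label L (col_pos D L i)"
      using L col_pos[OF assms(1)] col_pos[OF assms(2)]
      unfolding proper_labeling_def proper_line_labeling_def by blast
    then show False using col_pos[OF assms(1)] col_pos[OF assms(2)] assms(3) by simp
  qed
  then have "column D (col_pos D L i') \<subseteq> column D (col_pos D L i)"
    using D col_pos[OF assms(1)] col_pos[OF assms(2)]
    unfolding cross_shaped_grid_def vertically_nested_def by (meson not_le)
  then show ?thesis using assms(4) by (auto simp: pt_def labeled_point_def column_def)
qed

private lemma pt_mono_row:
  assumes "j \<in> {1..card (rows D)}" "j' \<in> {1..card (rows D)}" "j \<le> j'" "pt i j'"
  shows "pt i j"
proof -
  have "\<not> card (row D (row_pos D L j')) > card (row D (row_pos D L j))"
  proof
    assume "card (row D (row_pos D L j')) > card (row D (row_pos D L j))"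
    then have "row_label L (row_pos D L j') < row_label L (row_pos D L j)"
      using L row_pos[OF assms(1)] row_pos[OF assms(2)]
      unfolding proper_labeling_def proper_line_labeling_def by blast
    then show False using row_pos[OF assms(1)] row_pos[OF assms(2)] assms(3) by simp
  qed
  then have "row D (row_pos D L j') \<subseteq> row D (row_pos D L j)"
    using D row_pos[OF assms(1)] row_pos[OF assms(2)]
    unfolding cross_shaped_grid_def horizontally_nested_def by (meson not_le)
  then show ?thesis using assms(4) by (auto simp: pt_def labeled_point_def row_def)
qed

private abbreviation "V \<equiv> caracol_verts D"
private abbreviation less (infix \<open>\<lless>\<close> 50) where "u \<lless> v \<equiv> vless D L u v"

private lemma V_cases:
  assumes "v \<in> V"
  obtains "v = Source" | "v = Sink"
    | i where "v = Col i" "i \<in> {1..card (columns D)}"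
    | j where "v = Row j" "j \<in> {1..card (rows D)}"
  using assms by (auto simp: caracol_verts_def)

private lemma finV: "finite V"
  by (simp add: caracol_verts_def)

private lemma pt_less_col: "\<lbrakk>pt i' j; \<not> pt i j; Col i \<in> V; Col i' \<in> V\<rbrakk> \<Longrightarrow> i' < i"
  using pt_mono_col[of i i' j] by (force simp: caracol_verts_def)

private lemma pt_less_row: "\<lbrakk>pt i j'; \<not> pt i j; Row j \<in> V; Row j' \<in> V\<rbrakk> \<Longrightarrow> j' < j"
  using pt_mono_row[of j j' i] by (force simp: caracol_verts_def)

private lemma less_trans: "\<lbrakk>u \<in> V; v \<in> V; w \<in> V; u \<lless> v; v \<lless> w\<rbrakk> \<Longrightarrow> u \<lless> w"
  by (cases u; cases v; cases w; simp add: pt_def[symmetric])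
     (use pt_less_col pt_less_row less_asym in blast)+

private lemma less_irrefl: "\<not> v \<lless> v"
  by (cases v) auto

private lemma less_total: "\<lbrakk>u \<noteq> v\<rbrakk> \<Longrightarrow> u \<lless> v \<or> v \<lless> u"
  by (cases u; cases v) auto

private lemma order: "linear_order_on V (caracol_order D L)"
  unfolding linear_order_on_def partial_order_on_def preorder_on_def
  using less_trans less_irrefl less_total
  by (auto simp: caracol_order_def refl_on_def trans_def antisym_def total_on_def; blast)

private lemma ne: "1 \<le> card (columns D)" "1 \<le> card (rows D)"
  using D fin by (auto simp: cross_shaped_grid_def columns_def rows_def Suc_le_eq card_gt_0_iff)

private lemma pred_seg:
  assumes "v \<in> V" "v \<noteq> Source"
  shows "\<exists>u \<in> V. u \<lless> v \<and> \<not> (\<exists>w \<in> V. u \<lless> w \<and> w \<lless> v)"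
proof -
  let ?A = "{u \<in> V. u \<lless> v}"
  have "Source \<in> ?A" using assms by (cases v) (auto simp: caracol_verts_def)
  then have ne: "?A \<noteq> {}" by blast
  have fin: "finite ?A" using finV by simp
  have tr: "transp_on ?A (vless D L)"
    by (rule transp_onI) (use less_trans in blast)
  have as: "asymp_on ?A (vless D L)"
    by (rule asymp_onI) (use less_trans less_irrefl in blast)
  obtain u where u: "u \<in> ?A" and *: "\<forall>w\<in>?A. w \<noteq> u \<longrightarrow> \<not> u \<lless> w"
    using Finite_Set.bex_max_element[OF fin as tr ne] by blast
  have "u \<in> V \<and> u \<lless> v \<and> \<not> (\<exists>w \<in> V. u \<lless> w \<and> w \<lless> v)"
    using u * less_irrefl by auto
  then show ?thesis by blast
qed

private lemma succ_seg:
  assumes "v \<in> V" "v \<noteq> Sink"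
  shows "\<exists>u \<in> V. v \<lless> u \<and> \<not> (\<exists>w \<in> V. v \<lless> w \<and> w \<lless> u)"
proof -
  let ?A = "{u \<in> V. v \<lless> u}"
  have "Sink \<in> ?A" using assms by (cases v) (auto simp: caracol_verts_def)
  then have ne: "?A \<noteq> {}" by blast
  have fin: "finite ?A" using finV by simp
  have tr: "transp_on ?A (vless D L)"
    by (rule transp_onI) (use less_trans in blast)
  have as: "asymp_on ?A (vless D L)"
    by (rule asymp_onI) (use less_trans less_irrefl in blast)
  obtain u where u: "u \<in> ?A" and *: "\<forall>w\<in>?A. w \<noteq> u \<longrightarrow> \<not> w \<lless> u"
    using Finite_Set.bex_min_element[OF fin as tr ne] by blast
  have "u \<in> V \<and> v \<lless> u \<and> \<not> (\<exists>w \<in> V. v \<lless> w \<and> w \<lless> u)"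
    using u * less_irrefl by auto
  then show ?thesis by blast
qed

private lemma edge_verts:
  assumes "e \<in> caracol_edges D L"
  shows "edge_tail e \<in> V" "edge_head e \<in> V" "edge_tail e \<lless> edge_head e"
  using assms ne by (auto simp: caracol_edges_def) (auto simp: caracol_verts_def)

private lemma seg_iff:
  "Seg u v \<in> caracol_edges D L \<longleftrightarrow>
     u \<in> V \<and> v \<in> V \<and> u \<lless> v \<and> (\<forall>w \<in> V. u \<lless> w \<longrightarrow> \<not> w \<lless> v)"
  by (auto simp: caracol_edges_def)

private lemma seg_unique:
  assumes "Seg u v \<in> caracol_edges D L" "Seg u' v' \<in> caracol_edges D L"
  shows "u = u' \<longleftrightarrow> v = v'"
proof
  assume "u = u'"
  then show "v = v'" using assms less_total[of v v'] unfolding seg_iff by metis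
next
  assume "v = v'"
  then show "u = u'" using assms less_total[of u u'] unfolding seg_iff by metis
qed

private lemma edge_cases:
  assumes "e \<in> caracol_edges D L"
  obtains u v where "e = Seg u v"
    | i where "e = Arc Source (Col i)" "2 \<le> i"
    | j where "e = Arc (Row j) Sink" "2 \<le> j"
  using assms by (auto simp: caracol_edges_def)

private lemma height_inj:
  assumes "e \<in> caracol_edges D L" "f \<in> caracol_edges D L" "height D L e = height D L f"
    and "edge_head e = edge_head f \<or> edge_tail e = edge_tail f"
  shows "e = f"
proof (cases "\<exists>u v u' v'. e = Seg u v \<and> f = Seg u' v'")
  case True
  then obtain u v u' v' where ef: "e = Seg u v" "f = Seg u' v'" by blast
  then have "u = u' \<longleftrightarrow> v = v'" using seg_unique assms(1,2) by blast
  then show ?thesis using assms(4) ef by auto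
next
  case False
  show ?thesis
    by (rule edge_cases[OF assms(1)]; rule edge_cases[OF assms(2)])
       (use False assms(3,4) in \<open>auto split: if_splits\<close>)
qed

lemma framed_flow_graph_caracol:
  "framed_flow_graph (caracol_graph D L) (caracol_order D L) Source Sink
     (caracol_In D L) (caracol_Out D L)"
proof
  let ?G = "caracol_graph D L"
  have sel [simp]: "verts ?G = V" "arcs ?G = caracol_edges D L" "tail ?G = edge_tail" "head ?G = edge_head"
    by (simp_all add: caracol_graph_def)
  show "tail ?G e \<in> verts ?G" "head ?G e \<in> verts ?G" if "e \<in> arcs ?G" for e
    using that edge_verts by auto
  show "finite (verts ?G)" using finV by simp
  have "caracol_edges D L \<subseteq> (\<lambda>(u, v). Seg u v) ` (V \<times> V) \<union> (\<lambda>(u, v). Arc u v) ` (V \<times> V)"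
  proof
    fix e assume "e \<in> caracol_edges D L"
    then show "e \<in> (\<lambda>(u, v). Seg u v) ` (V \<times> V) \<union> (\<lambda>(u, v). Arc u v) ` (V \<times> V)"
      using edge_verts[of e] by (cases e) auto
  qed
  then show "finite (arcs ?G)" using finV by (auto intro: finite_subset)
  show "linear_order_on (verts ?G) (caracol_order D L)" using order by simp
  show "tail ?G e \<noteq> head ?G e \<and> (tail ?G e, head ?G e) \<in> caracol_order D L" if "e \<in> arcs ?G" for e
    using that edge_verts[of e] less_irrefl by (auto simp: caracol_order_def)
  show "Source \<in> verts ?G" "Sink \<in> verts ?G" by (auto simp: caracol_verts_def)
  show "in_arcs ?G v = {} \<longleftrightarrow> v = Source" if v_in: "v \<in> verts ?G" for v
  proof
    assume *: "in_arcs ?G v = {}"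
    show "v = Source"
    proof (rule ccontr)
      assume "v \<noteq> Source"
      then obtain u where "u \<in> V" "u \<lless> v" "\<not> (\<exists>w \<in> V. u \<lless> w \<and> w \<lless> v)"
        using pred_seg[of v] v_in unfolding sel by blast
      then have "Seg u v \<in> in_arcs ?G v" using v_in by (auto simp: caracol_edges_def)
      then show False using * by blast
    qed
  next
    assume "v = Source"
    then show "in_arcs ?G v = {}" using edge_verts(3) by (fastforce simp: in_arcs_def)
  qed
  show "out_arcs ?G v = {} \<longleftrightarrow> v = Sink" if v_in: "v \<in> verts ?G" for v
  proof
    assume *: "out_arcs ?G v = {}"
    show "v = Sink"
    proof (rule ccontr)
      assume "v \<noteq> Sink"
      then obtain u where "u \<in> V" "v \<lless> u" "\<not> (\<exists>w \<in> V. v \<lless> w \<and> w \<lless> u)"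
        using succ_seg[of v] v_in unfolding sel by blast
      then have "Seg v u \<in> out_arcs ?G v" using v_in by (auto simp: caracol_edges_def)
      then show False using * by blast
    qed
  next
    assume v: "v = Sink"
    have "\<not> Sink \<lless> u" for u by (cases u) auto
    then show "out_arcs ?G v = {}" using edge_verts(3) v by (fastforce simp: out_arcs_def)
  qed
  show "linear_order_on (in_arcs ?G v) (caracol_In D L v)" if "v \<in> verts ?G" for v
    unfolding linear_order_on_def partial_order_on_def preorder_on_def
    using height_inj
    by (auto simp: caracol_In_def refl_on_def trans_def antisym_def total_on_def)
  show "linear_order_on (out_arcs ?G v) (caracol_Out D L v)" if "v \<in> verts ?G" for v
    unfolding linear_order_on_def partial_order_on_def preorder_on_def
    using height_inj
    by (auto simp: caracol_Out_def refl_on_def trans_def antisym_def total_on_def)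
qed

end

end

theory Submission
  imports Defs
begin

text \<open>A route leaves the source towards a column \<open>x\<close>, follows the line, and leaves it from a row \<open>y\<close>;
  it exists iff column \<open>x\<close> precedes row \<open>y\<close>, so the routes are the points of \<open>D\<close>. Two routes share a
  vertex iff the corner of their bounding rectangle with the larger labels lies in \<open>D\<close>, which by
  properness means that the whole rectangle does. The labels grow away from column 1 and row 1 and
  the arcs are drawn on the corresponding sides, so at any common vertex the clockwise relation
  holds iff the second point is strictly north-east of the first. Hence incoherence is
  incompatibility, and cliques and their steps correspond to fillings and rotations.\<close>

section \<open>Lists of edges and the place where two of them diverge\<close>

lemma upt_split: "\<lbrakk>i \<le> j; j \<le> k\<rbrakk> \<Longrightarrow> [i..<k] = [i..<j] @ [j..<k]"
  using upt_add_eq_append[of i j "k - j"] by simp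

lemma upt_split_Cons: "\<lbrakk>i \<le> j; j < k\<rbrakk> \<Longrightarrow> [i..<k] = [i..<j] @ j # [Suc j..<k]"
  using upt_split[of i j k] by (simp add: upt_conv_Cons)

text \<open>Since \<open>e\<close> and \<open>f\<close> differ, \<open>R\<close> stops exactly at
  the first position where the two lists disagree, and so does \<open>R'\<close>.\<close>

lemma common_prefix_unique:
  assumes "R @ e # A = R' @ e' # A'" "R @ f # B = R' @ f' # B'" "e \<noteq> f" "e' \<noteq> f'"
  shows "R = R' \<and> e = e' \<and> f = f'"
  using assms by (induction R arbitrary: R') (auto simp: Cons_eq_append_conv append_eq_Cons_conv)

lemma common_suffix_unique:
  assumes "A @ e # R = A' @ e' # R'" "B @ f # R = B' @ f' # R'" "e \<noteq> f" "e' \<noteq> f'"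
  shows "R = R' \<and> e = e' \<and> f = f'"
proof -
  have "rev R @ e # rev A = rev R' @ e' # rev A'" "rev R @ f # rev B = rev R' @ f' # rev B'"
    using assms(1,2)[THEN arg_cong[of _ _ rev]] by simp_all
  from common_prefix_unique[OF this assms(3,4)] show ?thesis by simp
qed

context framed_flow_graph
begin

text \<open>The place of divergence is unique, so the existential in \<open>in_less\<close> can be
  tested on any one decomposition at hand.\<close>

lemma in_less_iff:
  assumes "path_upto P v = A @ e # R" "path_upto Q v = B @ f # R" "e \<noteq> f"
  shows "in_less v P Q \<longleftrightarrow> (e, f) \<in> In (head G e)"
proof
  assume "in_less v P Q"
  then obtain A' B' e' f' R' where *: "path_upto P v = A' @ e' # R'" "path_upto Q v = B' @ f' # R'"
    "e' \<noteq> f'" "(e', f') \<in> In (head G e')"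
    unfolding in_less_def by blast
  then show "(e, f) \<in> In (head G e)"
    using common_suffix_unique[of A e R A' e' R' B f B' f'] assms by simp
qed (use assms in \<open>unfold in_less_def, blast\<close>)

lemma out_less_iff:
  assumes "path_from v P = R @ e # A" "path_from v Q = R @ f # B" "e \<noteq> f"
  shows "out_less v P Q \<longleftrightarrow> (e, f) \<in> Out (tail G e)"
proof
  assume "out_less v P Q"
  then obtain A' B' e' f' R' where *: "path_from v P = R' @ e' # A'" "path_from v Q = R' @ f' # B'"
    "e' \<noteq> f'" "(e', f') \<in> Out (tail G e')"
    unfolding out_less_def by blast
  then show "(e, f) \<in> Out (tail G e)"
    using common_prefix_unique[of R e A R' e' A' f B f' B'] assms by simp
qed (use assms in \<open>unfold out_less_def, blast\<close>)

lemma in_less_irrefl: "path_upto P v = path_upto Q v \<Longrightarrow> \<not> in_less v P Q"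
  unfolding in_less_def by (auto simp: append_eq_append_conv2 Cons_eq_append_conv append_eq_Cons_conv)

lemma out_less_irrefl: "path_from v P = path_from v Q \<Longrightarrow> \<not> out_less v P Q"
  unfolding out_less_def by auto

end

section \<open>Intervals and sides in a proper labeling\<close>

text \<open>For \<open>k\<close> the larger of the two end labels, the lines with label at most
  \<open>k\<close> form an interval that contains both ends, hence everything between them.\<close>

lemma proper_line_labeling_between:
  assumes "proper_line_labeling S len lab" "x \<in> S" "x' \<in> S" "x \<le> z" "z \<le> x'"
  shows "z \<in> S \<and> lab z \<le> max (lab x) (lab x')"
proof -
  define k where "k = max (lab x) (lab x')"
  have "k \<in> {1..card S}"
    using assms(1-3) unfolding proper_line_labeling_def bij_betw_def k_def by (auto simp: max_def)
  then obtain l r where lr: "{x \<in> S. lab x \<le> k} = {l..r}"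
    using assms(1) unfolding proper_line_labeling_def by blast
  have "x \<in> {l..r}" "x' \<in> {l..r}"
    using assms(2,3) unfolding lr[symmetric] k_def by auto
  then have "z \<in> {x \<in> S. lab x \<le> k}"
    using assms(4,5) unfolding lr by simp
  then show ?thesis unfolding k_def by simp
qed

text \<open>The columns with labels below \<open>lab x\<close> form a block avoiding \<open>x\<close>, so \<open>x\<close> lies on the same
  side of all of them.\<close>

lemma proper_line_labeling_side:
  assumes "proper_line_labeling S len lab" "x \<in> S" "u \<in> S" "v \<in> S" "lab u < lab x" "lab v < lab x"
  shows "x < u \<longleftrightarrow> x < v"
proof (rule ccontr)
  assume "\<not> ?thesis"
  then have "u \<le> x \<and> x \<le> v \<or> v \<le> x \<and> x \<le> u" by linarith
  then have "lab x \<le> max (lab u) (lab v)"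
    using proper_line_labeling_between[OF assms(1)] assms(3,4) by (metis max.commute)
  then show False using assms(5,6) by simp
qed

lemma incompatible_sym: "incompatible D p q \<longleftrightarrow> incompatible D q p"
  by (auto simp: incompatible_def bounding_rectangle_def min.commute max.commute)

section \<open>Ranks of vertices on the horizontal line\<close>

locale labeled_grid =
  fixes D :: "point set" and L :: grid_labeling
  assumes grid: "cross_shaped_grid D" and labeling: "proper_labeling D L"
begin

sublocale framed_flow_graph "caracol_graph D L" "caracol_order D L" Source Sink
  "caracol_In D L" "caracol_Out D L"
  by (rule framed_flow_graph_caracol[OF grid labeling])

abbreviation "V \<equiv> caracol_verts D"
abbreviation "E \<equiv> caracol_edges D L"
abbreviation precedes (infix \<open>\<lless>\<close> 50) where "u \<lless> v \<equiv> vless D L u v"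

lemma caracol_graph_simps [simp]:
  "verts (caracol_graph D L) = V" "arcs (caracol_graph D L) = E"
  "tail (caracol_graph D L) = edge_tail" "head (caracol_graph D L) = edge_head"
  by (simp_all add: caracol_graph_def)

lemma finite_V: "finite V"
  by (simp add: caracol_verts_def)

lemma less_irrefl: "\<not> v \<lless> v"
  by (cases v) auto

lemma less_total: "u \<noteq> v \<Longrightarrow> u \<lless> v \<or> v \<lless> u"
  by (cases u; cases v) auto

lemma less_asym:
  assumes "u \<in> V" "v \<in> V" "u \<lless> v" shows "\<not> v \<lless> u"
proof
  assume "v \<lless> u"
  then have "u = v"
    using vord assms by (auto simp: linear_order_on_def partial_order_on_def antisym_def caracol_order_def)
  then show False using assms(3) less_irrefl by simp
qed

lemma less_trans:
  assumes "u \<in> V" "v \<in> V" "w \<in> V" "u \<lless> v" "v \<lless> w" shows "u \<lless> w"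
proof -
  have "trans (caracol_order D L)"
    using vord by (simp add: linear_order_on_def partial_order_on_def preorder_on_def)
  moreover have "(u, v) \<in> caracol_order D L" "(v, w) \<in> caracol_order D L"
    using assms by (auto simp: caracol_order_def)
  ultimately have "(u, w) \<in> caracol_order D L" by (rule transD)
  moreover have "u \<noteq> w" using assms less_asym by blast
  ultimately show ?thesis by (simp add: caracol_order_def)
qed

text \<open>Ranks counted from 0 turn a stretch of the line into a list \<open>[m..<n]\<close> and
  comparisons of vertices into arithmetic.\<close>

definition pos :: "vertex \<Rightarrow> nat" where
  "pos v = card {u \<in> V. u \<lless> v}"

definition node :: "nat \<Rightarrow> vertex" where
  "node = inv_into V pos"

lemma pos_mono: "\<lbrakk>u \<in> V; v \<in> V; u \<lless> v\<rbrakk> \<Longrightarrow> pos u < pos v"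
  unfolding pos_def
  by (rule psubset_card_mono) (simp add: finite_V, use less_trans less_irrefl in blast)

lemma pos_less_iff: "\<lbrakk>u \<in> V; v \<in> V\<rbrakk> \<Longrightarrow> pos u < pos v \<longleftrightarrow> u \<lless> v"
  using pos_mono less_total by (metis less_irrefl_nat order_less_asym)

lemma pos_eq_iff: "\<lbrakk>u \<in> V; v \<in> V\<rbrakk> \<Longrightarrow> pos u = pos v \<longleftrightarrow> u = v"
  using pos_mono less_total by (metis less_irrefl_nat)

text \<open>Ranks stay below \<open>card V\<close> because no vertex precedes itself. An injective
  map into a set of the same finite size is onto.\<close>

lemma bij_betw_pos: "bij_betw pos V {..<card V}"
proof -
  have inj: "inj_on pos V" by (rule inj_onI) (simp add: pos_eq_iff)
  have "pos v < card V" if "v \<in> V" for v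
    unfolding pos_def by (rule psubset_card_mono) (simp add: finite_V, use that less_irrefl in blast)
  then have "pos ` V \<subseteq> {..<card V}" by auto
  then have "pos ` V = {..<card V}" using card_image[OF inj] by (simp add: card_subset_eq)
  with inj show ?thesis by (simp add: bij_betw_def)
qed

lemma pos_less_card: "v \<in> V \<Longrightarrow> pos v < card V"
  using bij_betw_pos by (auto simp: bij_betw_def)

lemma node_pos [simp]: "v \<in> V \<Longrightarrow> node (pos v) = v"
  using bij_betw_pos unfolding node_def by (simp add: bij_betw_inv_into_left)

lemma pos_node [simp]: "k < card V \<Longrightarrow> pos (node k) = k"
  using bij_betw_pos unfolding node_def by (simp add: bij_betw_inv_into_right)

lemma node_in_V [simp]: "k < card V \<Longrightarrow> node k \<in> V"
  using bij_betw_pos unfolding node_def by (metis bij_betw_def inv_into_into lessThan_iff)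

lemma node_eq_iff: "\<lbrakk>k < card V; m < card V\<rbrakk> \<Longrightarrow> node k = node m \<longleftrightarrow> k = m"
  by (metis pos_node)

abbreviation seg :: "nat \<Rightarrow> edge" where
  "seg k \<equiv> Seg (node k) (node (Suc k))"

text \<open>Every rank below \<open>card V\<close> is attained, so a gap between the two ranks would
  yield a vertex strictly between the endpoints.\<close>

lemma Seg_in_E_iff: "Seg u v \<in> E \<longleftrightarrow> u \<in> V \<and> v \<in> V \<and> pos v = Suc (pos u)"
proof -
  have "Seg u v \<in> E \<longleftrightarrow> u \<in> V \<and> v \<in> V \<and> u \<lless> v \<and> \<not> (\<exists>w \<in> V. u \<lless> w \<and> w \<lless> v)"
    by (auto simp: caracol_edges_def)
  also have "\<dots> \<longleftrightarrow> u \<in> V \<and> v \<in> V \<and> pos u < pos v \<and> \<not> (\<exists>w \<in> V. pos u < pos w \<and> pos w < pos v)"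
    by (auto simp: pos_less_iff)
  also have "\<dots> \<longleftrightarrow> u \<in> V \<and> v \<in> V \<and> pos v = Suc (pos u)"
  proof -
    have "pos v = Suc (pos u)" if "u \<in> V" "v \<in> V" "pos u < pos v" "\<not> (\<exists>w \<in> V. pos u < pos w \<and> pos w < pos v)"
    proof (rule ccontr)
      assume "pos v \<noteq> Suc (pos u)"
      then have "Suc (pos u) < pos v" using that(3) by simp
      moreover have "pos v < card V" using that(2) by (rule pos_less_card)
      ultimately show False using that(4)[unfolded bex_simps] node_in_V[of "Suc (pos u)"]
        pos_node[of "Suc (pos u)"] by fastforce
    qed
    then show ?thesis by auto
  qed
  finally show ?thesis .
qed

lemma seg_in_E: "Suc k < card V \<Longrightarrow> seg k \<in> E"
  by (simp add: Seg_in_E_iff)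

lemma Seg_in_E_D: "Seg u v \<in> E \<Longrightarrow> Seg u v = seg (pos u) \<and> Suc (pos u) < card V"
  using pos_less_card[of v] node_pos[of v] by (auto simp: Seg_in_E_iff)

section \<open>Grid coordinates and the vertex order\<close>

abbreviation C :: "int \<Rightarrow> vertex" where "C x \<equiv> Col (col_label L x)"
abbreviation W :: "int \<Rightarrow> vertex" where "W y \<equiv> Row (row_label L y)"

lemma col_labeling: "proper_line_labeling (columns D) (\<lambda>x. card (column D x)) (col_label L)"
  and row_labeling: "proper_line_labeling (rows D) (\<lambda>y. card (row D y)) (row_label L)"
  using labeling by (simp_all add: proper_labeling_def)

lemma bij_betw_col_label: "bij_betw (col_label L) (columns D) {1..card (columns D)}"
  and bij_betw_row_label: "bij_betw (row_label L) (rows D) {1..card (rows D)}"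
  using col_labeling row_labeling by (simp_all add: proper_line_labeling_def)

lemma col_label_eq_iff: "\<lbrakk>x \<in> columns D; x' \<in> columns D\<rbrakk> \<Longrightarrow> col_label L x = col_label L x' \<longleftrightarrow> x = x'"
  using bij_betw_col_label by (auto simp: bij_betw_def dest: inj_onD)

lemma row_label_eq_iff: "\<lbrakk>y \<in> rows D; y' \<in> rows D\<rbrakk> \<Longrightarrow> row_label L y = row_label L y' \<longleftrightarrow> y = y'"
  using bij_betw_row_label by (auto simp: bij_betw_def dest: inj_onD)

lemma col_label_range: "x \<in> columns D \<Longrightarrow> col_label L x \<in> {1..card (columns D)}"
  using bij_betw_col_label by (rule bij_betw_apply)

lemma row_label_range: "y \<in> rows D \<Longrightarrow> row_label L y \<in> {1..card (rows D)}"
  using bij_betw_row_label by (rule bij_betw_apply)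

lemma col_pos_label [simp]: "x \<in> columns D \<Longrightarrow> col_pos D L (col_label L x) = x"
  unfolding col_pos_def using bij_betw_col_label by (simp add: bij_betw_inv_into_left)

lemma row_pos_label [simp]: "y \<in> rows D \<Longrightarrow> row_pos D L (row_label L y) = y"
  unfolding row_pos_def using bij_betw_row_label by (simp add: bij_betw_inv_into_left)

lemma col_pos_in: "i \<in> {1..card (columns D)} \<Longrightarrow> col_pos D L i \<in> columns D \<and> col_label L (col_pos D L i) = i"
  unfolding col_pos_def using bij_betw_col_label
  by (metis bij_betw_inv_into_right bij_betw_def inv_into_into)

lemma row_pos_in: "j \<in> {1..card (rows D)} \<Longrightarrow> row_pos D L j \<in> rows D \<and> row_label L (row_pos D L j) = j"
  unfolding row_pos_def using bij_betw_row_label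
  by (metis bij_betw_inv_into_right bij_betw_def inv_into_into)

lemma columns_nonempty: "1 \<in> {1..card (columns D)}" and rows_nonempty: "1 \<in> {1..card (rows D)}"
proof -
  obtain x y where "(x, y) \<in> D" using grid by (auto simp: cross_shaped_grid_def)
  then have "x \<in> columns D" "y \<in> rows D" by (force simp: columns_def rows_def)+
  then show "1 \<in> {1..card (columns D)}" "1 \<in> {1..card (rows D)}"
    using col_label_range[of x] row_label_range[of y] by auto
qed

lemma in_D_coords: "p \<in> D \<Longrightarrow> fst p \<in> columns D \<and> snd p \<in> rows D"
  by (simp add: columns_def rows_def)

lemma V_cases [consumes 1, case_names Source Sink Col Row]:
  assumes "v \<in> V"
  obtains "v = Source" | "v = Sink"
    | x where "v = C x" "x \<in> columns D"
    | y where "v = W y" "y \<in> rows D"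
proof -
  consider "v = Source" | "v = Sink"
    | i where "v = Col i" "i \<in> {1..card (columns D)}" | j where "v = Row j" "j \<in> {1..card (rows D)}"
    using assms unfolding caracol_verts_def by blast
  then show thesis
  proof cases
    case (3 i)
    then show thesis using that(3)[of "col_pos D L i"] col_pos_in[of i] by simp
  next
    case (4 j)
    then show thesis using that(4)[of "row_pos D L j"] row_pos_in[of j] by simp
  qed (use that in simp_all)
qed

lemma in_V [simp]: "Source \<in> V" "Sink \<in> V" "x \<in> columns D \<Longrightarrow> C x \<in> V" "y \<in> rows D \<Longrightarrow> W y \<in> V"
  using col_label_range row_label_range by (auto simp: caracol_verts_def)

lemma C_less_W_iff: "\<lbrakk>x \<in> columns D; y \<in> rows D\<rbrakk> \<Longrightarrow> pos (C x) < pos (W y) \<longleftrightarrow> (x, y) \<in> D"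
  by (simp add: pos_less_iff labeled_point_def)

lemma C_less_C_iff: "\<lbrakk>x \<in> columns D; x' \<in> columns D\<rbrakk> \<Longrightarrow>
    pos (C x) < pos (C x') \<longleftrightarrow> col_label L x < col_label L x'"
  by (simp add: pos_less_iff)

lemma W_less_W_iff: "\<lbrakk>y \<in> rows D; y' \<in> rows D\<rbrakk> \<Longrightarrow>
    pos (W y) < pos (W y') \<longleftrightarrow> row_label L y' < row_label L y"
  by (simp add: pos_less_iff)

lemma pos_Source [simp]: "pos Source = 0"
proof -
  have "{u \<in> V. u \<lless> Source} = {}" by simp
  then show ?thesis unfolding pos_def by simp
qed

lemma pos_C_pos: "x \<in> columns D \<Longrightarrow> 0 < pos (C x)"
  using pos_less_iff[of Source "C x"] by simp

section \<open>Edges of the caracol graph\<close>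

text \<open>No arc goes from the source to the column labeled 1; the first segment of the line takes
  its place. Thus each column has exactly one edge from the source, and dually each row has exactly
  one edge to the sink.\<close>

definition enter :: "int \<Rightarrow> edge" where
  "enter x = (if col_label L x = 1 then Seg else Arc) Source (C x)"

definition leave :: "int \<Rightarrow> edge" where
  "leave y = (if row_label L y = 1 then Seg else Arc) (W y) Sink"

lemma edge_enter [simp]: "edge_tail (enter x) = Source" "edge_head (enter x) = C x"
  and edge_leave [simp]: "edge_tail (leave y) = W y" "edge_head (leave y) = Sink"
  by (simp_all add: enter_def leave_def)

text \<open>Each row contains a point of some column, and that column precedes the row. As
  \<open>Col 1\<close> comes first among the columns, it also precedes all rows.\<close>

lemma Seg_Source_Col_1: "Seg Source (Col 1) \<in> E"
proof -
  let ?x = "col_pos D L 1"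
  have x: "?x \<in> columns D" "col_label L ?x = 1" using col_pos_in[OF columns_nonempty] by auto
  have "\<not> w \<lless> Col 1" if "w \<in> V" "Source \<lless> w" for w
    using that(1)
  proof (cases rule: V_cases)
    case (Col x')
    then show ?thesis using col_label_range[of x'] by simp
  next
    case (Row y)
    then obtain x' where x': "(x', y) \<in> D" by (auto simp: rows_def)
    then have "C x' \<lless> W y" "x' \<in> columns D"
      using C_less_W_iff pos_less_iff in_D_coords[OF x'] by auto
    moreover have "C x' = Col 1 \<or> Col 1 \<lless> C x'" using col_label_range[OF \<open>x' \<in> columns D\<close>] by auto
    ultimately have "Col 1 \<lless> W y" using less_trans[of "Col 1" "C x'" "W y"] x Row in_V(3)[OF x(1)] by auto
    then show ?thesis using less_asym[of "Col 1" "W y"] x Row in_V(3)[OF x(1)] by simp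
  qed (use that in simp_all)
  moreover have "Col 1 \<in> V" using in_V(3)[OF x(1)] x(2) by simp
  ultimately show ?thesis unfolding caracol_edges_def by auto
qed

lemma Seg_Row_1_Sink: "Seg (Row 1) Sink \<in> E"
proof -
  let ?y = "row_pos D L 1"
  have y: "?y \<in> rows D" "row_label L ?y = 1" using row_pos_in[OF rows_nonempty] by auto
  have "\<not> Row 1 \<lless> w" if "w \<in> V" "w \<lless> Sink" for w
    using that(1)
  proof (cases rule: V_cases)
    case (Row y')
    then show ?thesis using row_label_range[of y'] by simp
  next
    case (Col x)
    then obtain y' where y': "(x, y') \<in> D" by (auto simp: columns_def)
    then have "C x \<lless> W y'" "y' \<in> rows D"
      using C_less_W_iff pos_less_iff in_D_coords[OF y'] by auto
    moreover have "W y' = Row 1 \<or> W y' \<lless> Row 1" using row_label_range[OF \<open>y' \<in> rows D\<close>] by auto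
    ultimately have "C x \<lless> Row 1" using less_trans[of "C x" "W y'" "Row 1"] y Col in_V(4)[OF y(1)] by auto
    then show ?thesis using less_asym[of "C x" "Row 1"] y Col in_V(4)[OF y(1)] by simp
  qed (use that in simp_all)
  moreover have "Row 1 \<in> V" using in_V(4)[OF y(1)] y(2) by simp
  ultimately show ?thesis unfolding caracol_edges_def by auto
qed

lemma enter_in_E: "x \<in> columns D \<Longrightarrow> enter x \<in> E"
  using Seg_Source_Col_1 col_label_range[of x] by (auto simp: enter_def caracol_edges_def)

lemma leave_in_E: "y \<in> rows D \<Longrightarrow> leave y \<in> E"
  using Seg_Row_1_Sink row_label_range[of y] by (auto simp: leave_def caracol_edges_def)

text \<open>The first and last segments of the line count as \<open>enter\<close> and
  \<open>leave\<close>, so the middle case only joins inner vertices.\<close>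

lemma E_cases [consumes 1, case_names enter seg leave]:
  assumes "e \<in> E"
  obtains x where "x \<in> columns D" "e = enter x"
    | k where "0 < k" "Suc k < card V" "node (Suc k) \<noteq> Sink" "e = seg k"
    | y where "y \<in> rows D" "e = leave y"
proof -
  consider u v where "e = Seg u v" | i where "i \<in> {2..card (columns D)}" "e = Arc Source (Col i)"
    | j where "j \<in> {2..card (rows D)}" "e = Arc (Row j) Sink"
    using assms by (auto simp: caracol_edges_def)
  then show thesis
  proof cases
    case (1 u v)
    then have uv: "u \<in> V" "v \<in> V" "pos v = Suc (pos u)" "Suc (pos u) < card V" "e = seg (pos u)"
      using assms Seg_in_E_iff Seg_in_E_D by auto
    consider "u = Source" | "v = Sink" | "u \<noteq> Source" "v \<noteq> Sink" by blast
    then show thesis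
    proof cases
      case a: 1
      \<comment> \<open>\<open>Seg Source (Col 1)\<close> is an edge too, so \<open>Col 1\<close>
        has the same rank as \<open>v\<close>.\<close>
      then have "pos v = pos (Col 1)" "Col 1 \<in> V" using uv(3) Seg_Source_Col_1 Seg_in_E_iff by auto
      then have "v = Col 1" using uv pos_eq_iff by simp
      then show thesis using that(1)[of "col_pos D L 1"] 1 a col_pos_in[OF columns_nonempty]
        by (simp add: enter_def)
    next
      case a: 2
      then have "pos u = pos (Row 1)" "Row 1 \<in> V" using uv(3) Seg_Row_1_Sink Seg_in_E_iff by auto
      then have "u = Row 1" using uv pos_eq_iff by simp
      then show thesis using that(3)[of "row_pos D L 1"] 1 a row_pos_in[OF rows_nonempty]
        by (simp add: leave_def)
    next
      case 3
      then have "pos u \<noteq> 0" using pos_eq_iff[of u Source] uv(1) by simp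
      moreover have "node (Suc (pos u)) \<noteq> Sink" using node_pos[OF uv(2)] uv(3) 3 by simp
      ultimately show thesis using that(2)[of "pos u"] uv by simp
    qed
  next
    case (2 i)
    then show thesis using that(1)[of "col_pos D L i"] col_pos_in[of i] by (simp add: enter_def)
  next
    case (3 j)
    then show thesis using that(3)[of "row_pos D L j"] row_pos_in[of j] by (simp add: leave_def)
  qed
qed

section \<open>Routes as points of the grid\<close>

definition route :: "point \<Rightarrow> edge awalk" where
  "route p = enter (fst p) # map seg [pos (C (fst p))..<pos (W (snd p))] @ [leave (snd p)]"

lemma awalk_segs: "\<lbrakk>m \<le> n; n < card V\<rbrakk> \<Longrightarrow> awalk (node m) (map seg [m..<n]) (node n)"
  by (induction n rule: dec_induct) (auto simp: awalk_Nil_iff awalk_Cons_iff seg_in_E)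

lemma route_in_routes:
  assumes "p \<in> D"
  shows "route p \<in> routes"
proof -
  obtain x y where p: "p = (x, y)" by (cases p)
  then have xy: "x \<in> columns D" "y \<in> rows D" using in_D_coords assms by auto
  then have "pos (C x) < pos (W y)" using C_less_W_iff assms p by simp
  then have "awalk (C x) (map seg [pos (C x)..<pos (W y)]) (W y)"
    using awalk_segs[of "pos (C x)" "pos (W y)"] xy pos_less_card by simp
  then show ?thesis
    using xy by (auto simp: routes_def route_def p awalk_Cons_iff awalk_Nil_iff enter_in_E leave_in_E)
qed

lemma awalk_Sink: "awalk Sink P v \<Longrightarrow> P = []"
  using sink_iff[of Sink] by (cases P) (auto simp: awalk_Cons_iff out_arcs_def)

text \<open>From an inner vertex a path can only take the next segment or, at a row, exit to the
  sink, where it must end.\<close>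

lemma awalk_to_Sink:
  assumes "awalk (node k) P Sink" "0 < k" "k < card V" "node k \<noteq> Sink"
  shows "\<exists>y \<in> rows D. k \<le> pos (W y) \<and> P = map seg [k..<pos (W y)] @ [leave y]"
  using assms
proof (induction P arbitrary: k)
  case Nil
  then show ?case by (simp add: awalk_Nil_iff)
next
  case (Cons e P)
  then have e: "e \<in> E" "edge_tail e = node k" and P: "awalk (edge_head e) P Sink"
    by (auto simp: awalk_Cons_iff)
  from e(1) show ?case
  proof (cases rule: E_cases)
    case (enter x)
    then have "node k = Source" using e by simp
    then show ?thesis using pos_node[of k] Cons.prems by simp
  next
    case (seg m)
    then have "m = k" using e(2) node_eq_iff[of m k] Cons.prems by simp
    then obtain y where y: "y \<in> rows D" "Suc k \<le> pos (W y)" "P = map seg [Suc k..<pos (W y)] @ [leave y]"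
      using Cons.IH[of "Suc k"] P seg by auto
    then have "e # P = map seg [k..<pos (W y)] @ [leave y]"
      using seg \<open>m = k\<close> by (simp add: upt_conv_Cons)
    then show ?thesis using y(1,2) Suc_leD by blast
  next
    case (leave y)
    then have "k = pos (W y)" using e(2) pos_node[of k] Cons.prems by simp
    moreover have "P = []" using P leave awalk_Sink by simp
    ultimately show ?thesis using leave by auto
  qed
qed

lemma routes_eq: "routes = route ` D"
proof
  show "route ` D \<subseteq> routes" using route_in_routes by blast
  show "routes \<subseteq> route ` D"
  proof
    fix P assume "P \<in> routes"
    then have P: "awalk Source P Sink" by (simp add: routes_def)
    then obtain e Q where eQ: "P = e # Q" "e \<in> E" "edge_tail e = Source" "awalk (edge_head e) Q Sink"
      by (cases P) (auto simp: awalk_Cons_iff awalk_Nil_iff)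
    from eQ(2) show "P \<in> route ` D"
    proof (cases rule: E_cases)
      case (enter x)
      then obtain y where y: "y \<in> rows D" "pos (C x) \<le> pos (W y)"
        "Q = map seg [pos (C x)..<pos (W y)] @ [leave y]"
        using awalk_to_Sink[of "pos (C x)" Q] eQ pos_C_pos pos_less_card by auto
      \<comment> \<open>A column vertex is never a row vertex, so the weak inequality is strict and
        places \<open>(x, y)\<close> in \<open>D\<close>.\<close>
      moreover have "pos (C x) \<noteq> pos (W y)" using pos_eq_iff y enter by simp
      ultimately have "pos (C x) < pos (W y)" by simp
      then have "(x, y) \<in> D" using C_less_W_iff enter(1) y(1) by simp
      moreover have "P = route (x, y)" unfolding route_def eQ(1) enter(2) y(3) by simp
      ultimately show ?thesis by blast
    next
      case (seg k)
      then have "k = 0" using eQ(3) pos_node[of k] by simp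
      then show ?thesis using seg by simp
    qed (use eQ in simp)
  qed
qed

lemma route_split:
  assumes "p \<in> D" "pos (C (fst p)) \<le> m" "m \<le> pos (W (snd p))"
  shows "path_upto (route p) (node m) = enter (fst p) # map seg [pos (C (fst p))..<m]"
    and "path_from (node m) (route p) = map seg [m..<pos (W (snd p))] @ [leave (snd p)]"
proof -
  let ?A = "enter (fst p) # map seg [pos (C (fst p))..<m]"
  let ?B = "map seg [m..<pos (W (snd p))] @ [leave (snd p)]"
  have xy: "fst p \<in> columns D" "snd p \<in> rows D" using in_D_coords[of p] assms(1) by auto
  then have m: "0 < m" "pos (W (snd p)) < card V" "m < card V"
    using pos_C_pos[OF xy(1)] pos_less_card assms(2,3) le_less_trans[of m "pos (W (snd p))" "card V"] xy by auto
  have split: "route p = ?A @ ?B"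
    unfolding route_def using upt_split[OF assms(2,3)] by simp
  have "node m \<noteq> Source" using m pos_node[of m] by (metis less_irrefl_nat pos_Source)
  \<comment> \<open>Tails before the cut are the source, of rank 0, or nodes of rank below
    \<open>m\<close>, so \<open>takeWhile\<close> does not stop early.\<close>
  then have A: "\<forall>e \<in> set ?A. edge_tail e \<noteq> node m"
    using m by (auto simp: node_eq_iff dest: sym)
  obtain e B where B: "?B = e # B" "edge_tail e = node m"
  proof (cases "m = pos (W (snd p))")
    case True
    then show ?thesis using xy by (intro that[of "leave (snd p)" "[]"]) simp_all
  next
    case False
    then show ?thesis using assms(3)
      by (intro that[of "seg m" "map seg [Suc m..<pos (W (snd p))] @ [leave (snd p)]"]) (simp_all add: upt_conv_Cons)
  qed
  show "path_upto (route p) (node m) = ?A"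
    unfolding path_upto_def split B(1) using A B(2) by (subst takeWhile_append2) auto
  show "path_from (node m) (route p) = ?B"
    unfolding path_from_def split B(1) using A B(2) by (subst dropWhile_append2) auto
qed

lemma inner_verts_route:
  assumes "p \<in> D"
  shows "inner_verts (route p) = node ` {pos (C (fst p))..pos (W (snd p))}"
proof -
  have xy: "fst p \<in> columns D" "snd p \<in> rows D" using in_D_coords[of p] assms by auto
  then have lt: "pos (C (fst p)) < pos (W (snd p))" using C_less_W_iff assms by simp
  \<comment> \<open>Inner vertices are heads of edges: \<open>enter\<close> contributes the first,
    and \<open>seg k\<close> contributes \<open>node (Suc k)\<close>, whence the shift by
    one.\<close>
  have "{pos (C (fst p))..pos (W (snd p))} = insert (pos (C (fst p))) (Suc ` {pos (C (fst p))..<pos (W (snd p))})"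
    using lt by (auto simp: image_Suc_atLeastLessThan)
  then show ?thesis
    using xy by (simp add: inner_verts_def route_def butlast_append image_image del: image_Suc_atLeastLessThan)
qed

section \<open>The clockwise relation as north-east position\<close>

text \<open>The label of \<open>x\<close> exceeds 1, so \<open>enter x\<close> is an arc of nonzero
  height whose sign records the side of column 1. Both column 1 and \<open>x'\<close> have smaller
  labels than \<open>x\<close>, so \<open>x\<close> lies on the same side of both.\<close>

lemma height_enter:
  assumes "x \<in> columns D" "x' \<in> columns D" "col_label L x' < col_label L x"
  shows "0 \<le> height D L (enter x) \<longleftrightarrow> x < x'" "height D L (enter x) \<le> 0 \<longleftrightarrow> x' < x"
proof -
  let ?c = "col_pos D L 1"
  have l: "col_label L x' \<ge> 1" using col_label_range assms(2) by simp
  have "x < ?c \<longleftrightarrow> x < x'"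
    using proper_line_labeling_side[OF col_labeling, of x ?c x'] assms l col_pos_in[OF columns_nonempty]
    by simp
  moreover have "x \<noteq> x'" using assms(3) by auto
  ultimately show "0 \<le> height D L (enter x) \<longleftrightarrow> x < x'" "height D L (enter x) \<le> 0 \<longleftrightarrow> x' < x"
    using assms l by (auto simp: enter_def)
qed

lemma height_leave:
  assumes "y \<in> rows D" "y' \<in> rows D" "row_label L y' < row_label L y"
  shows "0 \<le> height D L (leave y) \<longleftrightarrow> y' < y" "height D L (leave y) \<le> 0 \<longleftrightarrow> y < y'"
proof -
  let ?c = "row_pos D L 1"
  have l: "row_label L y' \<ge> 1" using row_label_range assms(2) by simp
  have "y < ?c \<longleftrightarrow> y < y'"
    using proper_line_labeling_side[OF row_labeling, of y ?c y'] assms l row_pos_in[OF rows_nonempty]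
    by simp
  moreover have "y \<noteq> y'" using assms(3) by auto
  moreover have "y \<noteq> ?c" using assms(3) l row_pos_in[OF rows_nonempty] by auto
  ultimately show "0 \<le> height D L (leave y) \<longleftrightarrow> y' < y" "height D L (leave y) \<le> 0 \<longleftrightarrow> y < y'"
    using assms l by (auto simp: leave_def)
qed

text \<open>The column with the larger label joins the line later, and it does so by an arc, while the other
  path arrives there along the line.\<close>

lemma in_less_enter:
  assumes x: "x \<in> columns D" "x' \<in> columns D" "col_label L x' < col_label L x"
    and m: "pos (C x) \<le> m"
    and P: "path_upto P v = enter x # map seg [pos (C x)..<m]"
    and Q: "path_upto Q v = enter x' # map seg [pos (C x')..<m]"
  shows "in_less v P Q \<longleftrightarrow> x < x'" "in_less v Q P \<longleftrightarrow> x' < x"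
proof -
  \<comment> \<open>\<open>seg k\<close> is the segment into \<open>C x\<close>. From there on both
    paths run along the line, so they diverge, read backwards, at \<open>enter x\<close> against
    \<open>seg k\<close>.\<close>
  define k where "k = pos (C x) - 1"
  have lt: "pos (C x') < pos (C x)" using C_less_C_iff x by simp
  then have k: "pos (C x) = Suc k" "pos (C x') \<le> k" "Suc k < card V"
    using pos_less_card[OF in_V(3)[OF x(1)]] by (auto simp: k_def)
  have Q': "path_upto Q v = (enter x' # map seg [pos (C x')..<k]) @ seg k # map seg [pos (C x)..<m]"
    using k(1) m unfolding Q upt_split_Cons[OF k(2), of m, OF less_le_trans[OF lessI m[unfolded k(1)]]] by simp
  have P': "path_upto P v = [] @ enter x # map seg [pos (C x)..<m]" using P by simp
  have ne: "enter x \<noteq> seg k" using x(3) col_label_range[OF x(2)] by (auto simp: enter_def)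
  have head: "node (Suc k) = C x" using node_pos[OF in_V(3)[OF x(1)]] k(1) by simp
  have E: "enter x \<in> E" "seg k \<in> E" using x(1) k(3) enter_in_E seg_in_E by auto
  show "in_less v P Q \<longleftrightarrow> x < x'" "in_less v Q P \<longleftrightarrow> x' < x"
    unfolding in_less_iff[OF P' Q' ne] in_less_iff[OF Q' P' ne[symmetric]]
    using E head height_enter[OF x] by (auto simp: caracol_In_def)
qed

text \<open>Rows with larger labels come earlier on the line. At \<open>W y\<close> one path leaves
  by an arc while the other stays on the line at height 0, so the sign of the arc's height
  decides.\<close>

lemma out_less_leave:
  assumes y: "y \<in> rows D" "y' \<in> rows D" "row_label L y' < row_label L y"
    and m: "m \<le> pos (W y)"
    and P: "path_from v P = map seg [m..<pos (W y)] @ [leave y]"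
    and Q: "path_from v Q = map seg [m..<pos (W y')] @ [leave y']"
  shows "out_less v P Q \<longleftrightarrow> y' < y" "out_less v Q P \<longleftrightarrow> y < y'"
proof -
  have lt: "pos (W y) < pos (W y')" using W_less_W_iff y by simp
  then have k: "Suc (pos (W y)) < card V"
    using pos_less_card[OF in_V(4)[OF y(2)]] by simp
  have Q': "path_from v Q =
      map seg [m..<pos (W y)] @ seg (pos (W y)) # map seg [Suc (pos (W y))..<pos (W y')] @ [leave y']"
    unfolding Q upt_split_Cons[OF m lt] by simp
  have ne: "leave y \<noteq> seg (pos (W y))" using y(3) row_label_range[OF y(2)] by (auto simp: leave_def)
  have E: "leave y \<in> E" "seg (pos (W y)) \<in> E" using leave_in_E[OF y(1)] seg_in_E[OF k] by simp_all
  show "out_less v P Q \<longleftrightarrow> y' < y" "out_less v Q P \<longleftrightarrow> y < y'"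
    unfolding out_less_iff[OF P Q' ne] out_less_iff[OF Q' P ne[symmetric]]
    using E in_V(4)[OF y(1)] height_leave[OF y] by (auto simp: caracol_Out_def)
qed

text \<open>The incoming parts are compared by the columns alone and the outgoing parts by the rows
  alone; equal labels give equal parts. Hence the answer is the same at every common vertex.\<close>

lemma cw_less_node_iff:
  assumes p: "p \<in> D" "pos (C (fst p)) \<le> m" "m \<le> pos (W (snd p))"
    and q: "q \<in> D" "pos (C (fst q)) \<le> m" "m \<le> pos (W (snd q))"
  shows "cw_less (node m) (route p) (route q) \<longleftrightarrow> strictly_NE q p"
proof -
  have p': "fst p \<in> columns D" "snd p \<in> rows D" and q': "fst q \<in> columns D" "snd q \<in> rows D"
    using in_D_coords[of p] in_D_coords[of q] p q by auto
  have "in_less (node m) (route p) (route q) \<longleftrightarrow> fst p < fst q"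
  proof (cases "col_label L (fst p)" "col_label L (fst q)" rule: linorder_cases)
    case less
    then show ?thesis
      using in_less_enter(2)[OF q'(1) p'(1) less q(2) route_split(1)[OF q] route_split(1)[OF p]] by simp
  next
    case equal
    then have "fst p = fst q" using p' q' col_label_eq_iff by simp
    then show ?thesis using in_less_irrefl route_split(1)[OF p] route_split(1)[OF q] by simp
  next
    case greater
    then show ?thesis
      using in_less_enter(1)[OF p'(1) q'(1) greater p(2) route_split(1)[OF p] route_split(1)[OF q]] by simp
  qed
  \<comment> \<open>The arguments are swapped as in \<open>cw_less\<close>: the outgoing edge drawn
    higher comes first, and it belongs to the higher row.\<close>
  moreover have "out_less (node m) (route q) (route p) \<longleftrightarrow> snd p < snd q"
  proof (cases "row_label L (snd p)" "row_label L (snd q)" rule: linorder_cases)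
    case less
    then show ?thesis
      using out_less_leave(1)[OF q'(2) p'(2) less q(3) route_split(2)[OF q] route_split(2)[OF p]] by simp
  next
    case equal
    then have "snd p = snd q" using p' q' row_label_eq_iff by simp
    then show ?thesis using out_less_irrefl route_split(2)[OF p] route_split(2)[OF q] by simp
  next
    case greater
    then show ?thesis
      using out_less_leave(2)[OF p'(2) q'(2) greater p(3) route_split(2)[OF p] route_split(2)[OF q]] by simp
  qed
  moreover have "node m \<in> inner_verts (route p) \<inter> inner_verts (route q)"
    using p q by (auto simp: inner_verts_route)
  ultimately show ?thesis by (simp add: cw_less_def strictly_NE_def)
qed

text \<open>The corner of the rectangle in the column and row with the larger labels decides both whether
  the rectangle lies in \<open>D\<close> and whether the two routes share a vertex.\<close>

lemma rectangle_subset_iff: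
  assumes "p \<in> D" "q \<in> D"
  shows "bounding_rectangle p q \<subseteq> D \<longleftrightarrow>
    max (pos (C (fst p))) (pos (C (fst q))) \<le> min (pos (W (snd p))) (pos (W (snd q)))"
proof -
  have p': "fst p \<in> columns D" "snd p \<in> rows D" and q': "fst q \<in> columns D" "snd q \<in> rows D"
    using in_D_coords[of p] in_D_coords[of q] assms by auto
  have ne: "pos (C x) \<noteq> pos (W y)" if "x \<in> columns D" "y \<in> rows D" for x y
    using that pos_eq_iff by simp
  show ?thesis
  proof
    assume R: "bounding_rectangle p q \<subseteq> D"
    \<comment> \<open>Only the four corners of the rectangle are needed here.\<close>
    have "(x, y) \<in> D" if "x = fst p \<or> x = fst q" "y = snd p \<or> y = snd q" for x y
      using R that by (auto simp: bounding_rectangle_def)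
    then have "pos (C x) \<le> pos (W y)" if "x = fst p \<or> x = fst q" "y = snd p \<or> y = snd q" for x y
      using that C_less_W_iff[of x y] p' q' by (metis less_imp_le)
    then show "max (pos (C (fst p))) (pos (C (fst q))) \<le> min (pos (W (snd p))) (pos (W (snd q)))"
      by simp
  next
    assume le: "max (pos (C (fst p))) (pos (C (fst q))) \<le> min (pos (W (snd p))) (pos (W (snd q)))"
    show "bounding_rectangle p q \<subseteq> D"
    proof
      fix z assume "z \<in> bounding_rectangle p q"
      then obtain x y where z: "z = (x, y)"
        and x: "min (fst p) (fst q) \<le> x" "x \<le> max (fst p) (fst q)"
        and y: "min (snd p) (snd q) \<le> y" "y \<le> max (snd p) (snd q)"
        by (auto simp: bounding_rectangle_def)
      \<comment> \<open>Labels inside the rectangle do not exceed the larger end label. As columns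
        appear by increasing and rows by decreasing label, \<open>C x\<close> comes no later than
        the later column and \<open>W y\<close> no earlier than the earlier row.\<close>
      have "x \<in> columns D" "col_label L x \<le> max (col_label L (fst p)) (col_label L (fst q))"
        using proper_line_labeling_between[OF col_labeling _ _ x] p' q'
        by (cases "fst p \<le> fst q"; simp add: max.commute)+
      moreover have "y \<in> rows D" "row_label L y \<le> max (row_label L (snd p)) (row_label L (snd q))"
        using proper_line_labeling_between[OF row_labeling _ _ y] p' q'
        by (cases "snd p \<le> snd q"; simp add: max.commute)+
      ultimately have "pos (C x) \<le> max (pos (C (fst p))) (pos (C (fst q)))"
        "min (pos (W (snd p))) (pos (W (snd q))) \<le> pos (W y)"
        using p' q' C_less_C_iff W_less_W_iff by (auto simp: le_max_iff_disj min_le_iff_disj not_less[symmetric])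
      then have "pos (C x) \<le> pos (W y)" using le by linarith
      then have "pos (C x) < pos (W y)" using ne \<open>x \<in> columns D\<close> \<open>y \<in> rows D\<close> le_neq_implies_less by blast
      then show "z \<in> D" using C_less_W_iff \<open>x \<in> columns D\<close> \<open>y \<in> rows D\<close> z by simp
    qed
  qed
qed

lemma ex_cw_less_iff:
  assumes "p \<in> D" "q \<in> D"
  shows "(\<exists>v. cw_less v (route p) (route q)) \<longleftrightarrow> strictly_NE q p \<and> bounding_rectangle p q \<subseteq> D"
proof -
  \<comment> \<open>A common vertex comes with one rank from each route; this identifies the
    two.\<close>
  have eq: "m = k" if "node m = node k" "m \<le> pos (W (snd p))" "k \<le> pos (W (snd q))" for m k
    using that assms pos_less_card in_V(4) in_D_coords[of p] in_D_coords[of q]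
    by (metis le_less_trans node_eq_iff prod.collapse)
  show ?thesis
  proof
    assume "\<exists>v. cw_less v (route p) (route q)"
    then obtain v where v: "cw_less v (route p) (route q)" by blast
    then have "v \<in> inner_verts (route p) \<inter> inner_verts (route q)" by (simp add: cw_less_def)
    then obtain m where m: "v = node m" "pos (C (fst p)) \<le> m" "m \<le> pos (W (snd p))"
      "pos (C (fst q)) \<le> m" "m \<le> pos (W (snd q))"
      using eq by (force simp: inner_verts_route assms)
    then have "bounding_rectangle p q \<subseteq> D" using rectangle_subset_iff assms by simp
    moreover have "strictly_NE q p" using cw_less_node_iff assms m v by simp
    ultimately show "strictly_NE q p \<and> bounding_rectangle p q \<subseteq> D" by simp
  next
    assume R: "strictly_NE q p \<and> bounding_rectangle p q \<subseteq> D"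
    \<comment> \<open>The first common vertex: the place where the later route joins the
      line.\<close>
    let ?m = "max (pos (C (fst p))) (pos (C (fst q)))"
    have "?m \<le> min (pos (W (snd p))) (pos (W (snd q)))" using R rectangle_subset_iff assms by simp
    then have "cw_less (node ?m) (route p) (route q)"
      using cw_less_node_iff[of p ?m q] R assms by simp
    then show "\<exists>v. cw_less v (route p) (route q)" by blast
  qed
qed

lemma coherent_route_iff:
  assumes "p \<in> D" "q \<in> D"
  shows "coherent (route p) (route q) \<longleftrightarrow> \<not> incompatible D p q"
proof -
  have "coherent (route p) (route q) \<longleftrightarrow>
      \<not> (\<exists>v. cw_less v (route p) (route q)) \<and> \<not> (\<exists>v. cw_less v (route q) (route p))"
    unfolding coherent_def incoherent_at_def cw_less_def by blast
  moreover have "bounding_rectangle q p = bounding_rectangle p q"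
    by (simp add: bounding_rectangle_def min.commute max.commute)
  ultimately show ?thesis
    using ex_cw_less_iff assms by (auto simp: incompatible_def)
qed

section \<open>Cliques, fillings and rotations\<close>

lemma inj_on_route: "inj_on route D"
proof (rule inj_onI)
  fix p q assume pq: "p \<in> D" "q \<in> D" "route p = route q"
  \<comment> \<open>The first edge carries the column label and the last edge the row label.\<close>
  then have "hd (route p) = hd (route q)" "last (route p) = last (route q)" by simp_all
  then have "col_label L (fst p) = col_label L (fst q)" "row_label L (snd p) = row_label L (snd q)"
    by (auto simp: route_def enter_def leave_def split: if_splits)
  then show "p = q"
    using pq in_D_coords[of p] in_D_coords[of q]
    by (simp add: col_label_eq_iff row_label_eq_iff prod_eq_iff)
qed

lemma clique_route_iff: "T \<subseteq> D \<Longrightarrow> clique (route ` T) \<longleftrightarrow> filling D T"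
proof -
  assume "T \<subseteq> D"
  moreover from this have "coherent (route p) (route q) \<longleftrightarrow> \<not> incompatible D p q"
    "route p = route q \<longleftrightarrow> p = q" if "p \<in> T" "q \<in> T" for p q
    using that coherent_route_iff inj_on_eq_iff[OF inj_on_route] by blast+
  ultimately show ?thesis
    by (auto simp: clique_def filling_def routes_eq pairwise_def)
qed

lemma clique_imp_image:
  assumes "clique K" obtains T where "T \<subseteq> D" "K = route ` T"
  using assms by (auto simp: clique_def routes_eq subset_image_iff)

text \<open>Every clique is the image of a subset of \<open>D\<close>. By injectivity, inclusions
  between images are inclusions between point sets, so maximality transfers both ways.\<close>

lemma maximal_clique_route_iff:
  assumes T: "T \<subseteq> D"
  shows "route ` T \<in> maximal_cliques \<longleftrightarrow> T \<in> maximal_fillings D"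
proof
  assume K: "route ` T \<in> maximal_cliques"
  have "T' = T" if T': "filling D T'" "T \<subseteq> T'" for T'
  proof -
    have "T' \<subseteq> D" using T'(1) by (simp add: filling_def)
    then have "clique (route ` T')" using T'(1) clique_route_iff by simp
    then have "route ` T' = route ` T"
      using K image_mono[OF T'(2), of route] by (simp add: maximal_cliques_def)
    then show "T' = T" using inj_on_image_eq_iff[OF inj_on_route \<open>T' \<subseteq> D\<close> T] by simp
  qed
  then show "T \<in> maximal_fillings D"
    using K clique_route_iff[OF T] by (simp add: maximal_cliques_def maximal_fillings_def)
next
  assume F: "T \<in> maximal_fillings D"
  have "K = route ` T" if K: "clique K" "route ` T \<subseteq> K" for K
  proof -
    obtain T' where T': "T' \<subseteq> D" "K = route ` T'" using K(1) by (rule clique_imp_image)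
    have "T \<subseteq> T'"
    proof
      fix p assume "p \<in> T"
      then have "route p \<in> route ` T'" using K(2) T'(2) by blast
      then show "p \<in> T'" using inj_on_image_mem_iff[OF inj_on_route _ T'(1)] T \<open>p \<in> T\<close> by blast
    qed
    moreover have "filling D T'" using K(1) T' clique_route_iff by simp
    ultimately have "T' = T" using F unfolding maximal_fillings_def by blast
    then show "K = route ` T" using T'(2) by simp
  qed
  then show "route ` T \<in> maximal_cliques"
    using F clique_route_iff[OF T] by (simp add: maximal_cliques_def maximal_fillings_def)
qed

lemma maximal_fillings_subset: "T \<in> maximal_fillings D \<Longrightarrow> T \<subseteq> D"
  by (simp add: maximal_fillings_def filling_def)

lemma maximal_cliques_eq: "maximal_cliques = (`) route ` maximal_fillings D"
proof
  show "maximal_cliques \<subseteq> (`) route ` maximal_fillings D"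
  proof
    fix K assume K: "K \<in> maximal_cliques"
    then have "clique K" by (simp add: maximal_cliques_def)
    then obtain T where "T \<subseteq> D" "K = route ` T" by (rule clique_imp_image)
    then show "K \<in> (`) route ` maximal_fillings D" using K maximal_clique_route_iff by simp
  qed
  show "(`) route ` maximal_fillings D \<subseteq> maximal_cliques"
    using maximal_clique_route_iff maximal_fillings_subset by blast
qed

text \<open>A rotation does not mention the rectangle. It lies in \<open>D\<close> because \<open>T\<close> is maximal:
  \<open>p'\<close> is incompatible with some point of \<open>T\<close>, and \<open>p\<close> is the only candidate.\<close>

lemma rotation_incompatible:
  assumes "T \<in> maximal_fillings D" "T' \<in> maximal_fillings D" "p \<in> T" "p' \<in> T'"
    "T - {p} = T' - {p'}" "p \<noteq> p'"
  shows "incompatible D p p'"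
proof (rule ccontr)
  assume c: "\<not> incompatible D p p'"
  have T: "pairwise (\<lambda>p p'. \<not> incompatible D p p') T" "pairwise (\<lambda>p p'. \<not> incompatible D p p') T'"
    using assms(1,2) by (simp_all add: maximal_fillings_def filling_def)
  have "\<not> incompatible D p' q" if q: "q \<in> T" "q \<noteq> p'" for q
  proof (cases "q = p")
    case True
    then show ?thesis using c incompatible_sym[of D p p'] by simp
  next
    case False
    then have "q \<in> T - {p}" using q(1) by simp
    then have "q \<in> T'" unfolding assms(5) by simp
    then show ?thesis using pairwiseD[OF T(2) assms(4)] q(2) by blast
  qed
  then have "pairwise (\<lambda>p p'. \<not> incompatible D p p') (insert p' T)"
    using T(1) incompatible_sym[of D p'] by (simp add: pairwise_insert)
  moreover have "p' \<in> D" using subsetD[OF maximal_fillings_subset[OF assms(2)] assms(4)] .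
  ultimately have "filling D (insert p' T)" using maximal_fillings_subset[OF assms(1)] by (simp add: filling_def)
  moreover have "\<forall>T'. filling D T' \<and> T \<subseteq> T' \<longrightarrow> T' = T"
    using assms(1) by (simp add: maximal_fillings_def)
  \<comment> \<open>By maximality \<open>p'\<close> already lies in \<open>T\<close>, hence in
    \<open>T - {p}\<close>. This set equals \<open>T' - {p'}\<close>, a contradiction.\<close>
  ultimately have "insert p' T = T" using subset_insertI[of T p'] by blast
  then have "p' \<in> T - {p}" using assms(6) by blast
  then show False unfolding assms(5) by simp
qed

text \<open>A step asks for a vertex witnessing the clockwise relation, a rotation only for
  north-east position. The missing rectangle comes from \<open>rotation_incompatible\<close>, and
  \<open>ex_cw_less_iff\<close> turns it into a vertex.\<close>

lemma clique_step_route_iff: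
  assumes T: "T \<in> maximal_fillings D" and T': "T' \<in> maximal_fillings D"
  shows "(route ` T, route ` T') \<in> clique_step \<longleftrightarrow> (T, T') \<in> increasing_rotation D"
proof -
  have D: "T \<subseteq> D" "T' \<subseteq> D" using T T' maximal_fillings_subset by auto
  have image_diff: "route ` (T - {p}) = route ` T - {route p}" if "p \<in> T" for p
    using inj_on_image_set_diff[OF inj_on_route, of T "{p}"] that D(1) by auto
  have max: "route ` T \<in> maximal_cliques" "route ` T' \<in> maximal_cliques"
    using T T' D maximal_clique_route_iff by auto
  show ?thesis
  proof
    assume "(route ` T, route ` T') \<in> clique_step"
    then obtain R R' u where R: "R \<in> route ` T" "route ` T' = insert R' (route ` T - {R})" "cw_less u R R'"
      unfolding clique_step_def by blast
    obtain p where p1: "p \<in> T" "R = route p" using R(1) by (rule imageE)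
    have "R' \<in> route ` T'" using R(2) by simp
    then obtain p' where p2: "p' \<in> T'" "R' = route p'" by (rule imageE)
    note p = p1 p2
    have pD: "p \<in> D" "p' \<in> D" using subsetD[OF D(1) p(1)] subsetD[OF D(2) p(3)] .
    have NE: "strictly_NE p' p" "bounding_rectangle p p' \<subseteq> D"
      using ex_cw_less_iff[OF pD] R(3) p by auto
    then have "incompatible D p p'" "p \<noteq> p'" by (auto simp: incompatible_def strictly_NE_def)
    \<comment> \<open>Were \<open>p'\<close> already in \<open>T\<close>, deleting it from
      \<open>T'\<close> would remove more than the exchanged point.\<close>
    then have "p' \<notin> T" using T p(1) by (auto simp: maximal_fillings_def filling_def pairwise_def)
    have "route ` T' = route ` insert p' (T - {p})"
      using R(2) p D pD by (simp add: image_diff)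
    then have "T' = insert p' (T - {p})"
      using inj_on_image_eq_iff[OF inj_on_route, of T' "insert p' (T - {p})"] D pD by auto
    then have "T - {p} = T' - {p'}" using \<open>p' \<notin> T\<close> by simp
    then show "(T, T') \<in> increasing_rotation D"
      unfolding increasing_rotation_def using T T' p NE by blast
  next
    assume "(T, T') \<in> increasing_rotation D"
    then obtain p p' where p: "p \<in> T" "p' \<in> T'" "T - {p} = T' - {p'}" "strictly_NE p' p"
      unfolding increasing_rotation_def by blast
    then have "p \<noteq> p'" by (auto simp: strictly_NE_def)
    then have "bounding_rectangle p p' \<subseteq> D"
      using rotation_incompatible[OF T T' p(1-3)] by (simp add: incompatible_def)
    then obtain u where "cw_less u (route p) (route p')"
      using ex_cw_less_iff[OF subsetD[OF D(1) p(1)] subsetD[OF D(2) p(2)]] p(4) by blast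
    moreover have "T' = insert p' (T - {p})" using p(3) insert_Diff[OF p(2)] by simp
    then have "route ` T' = insert (route p') (route ` T - {route p})"
      using image_diff[OF p(1)] by simp
    ultimately show "(route ` T, route ` T') \<in> clique_step"
      unfolding clique_step_def using max p(1) by blast
  qed
qed

section \<open>The isomorphism of the two orders\<close>

lemma inj_on_image_route: "inj_on ((`) route) (maximal_fillings D)"
  by (rule inj_onI) (use inj_on_image_eq_iff[OF inj_on_route maximal_fillings_subset maximal_fillings_subset] in simp)

text \<open>Steps join maximal cliques only, so each intermediate member of a chain is the image of
  a maximal filling and the chain can be pulled back one step at a time.\<close>

lemma clique_steps_route_iff:
  assumes T: "T \<in> maximal_fillings D" and T': "T' \<in> maximal_fillings D"
  shows "(route ` T, route ` T') \<in> clique_step\<^sup>* \<longleftrightarrow> (T, T') \<in> (increasing_rotation D)\<^sup>*"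
proof
  assume "(T, T') \<in> (increasing_rotation D)\<^sup>*"
  then show "(route ` T, route ` T') \<in> clique_step\<^sup>*"
  proof (induction rule: rtrancl_induct)
    case (step U U')
    moreover have "U \<in> maximal_fillings D" "U' \<in> maximal_fillings D"
      using step.hyps(2) by (auto simp: increasing_rotation_def)
    ultimately have "(route ` U, route ` U') \<in> clique_step" using clique_step_route_iff by simp
    with step.IH show ?case by (rule rtrancl_into_rtrancl)
  qed simp
next
  assume "(route ` T, route ` T') \<in> clique_step\<^sup>*"
  then show "(T, T') \<in> (increasing_rotation D)\<^sup>*"
    using T'
  proof (induction "route ` T'" arbitrary: T' rule: rtrancl_induct)
    \<comment> \<open>A chain of length 0 only says that the two images agree; injectivity gives
      equality of the fillings.\<close>
    case base
    then show ?case using T inj_on_image_route by (auto dest: inj_onD)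
  next
    case (step K)
    then obtain U where U: "K = route ` U" "U \<in> maximal_fillings D"
      using maximal_cliques_eq by (auto simp: clique_step_def)
    then have "(U, T') \<in> increasing_rotation D" using step clique_step_route_iff by simp
    moreover have "(T, U) \<in> (increasing_rotation D)\<^sup>*" using step U by simp
    ultimately show ?case by simp
  qed
qed

text \<open>Taking images under \<open>route\<close> leads from fillings to cliques, against the
  required direction; hence the inverse.\<close>

lemma iso_route: "iso framing_lattice (Tam D) (inv_into (maximal_fillings D) ((`) route))"
proof -
  have F: "Field (Tam D) = maximal_fillings D" "Field framing_lattice = maximal_cliques"
    by (auto simp: Field_def Tam_def framing_lattice_def)
  have bij: "bij_betw ((`) route) (maximal_fillings D) maximal_cliques"
    using inj_on_image_route maximal_cliques_eq by (simp add: bij_betw_def)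
  have "(K, K') \<in> framing_lattice \<longleftrightarrow>
      (inv_into (maximal_fillings D) ((`) route) K, inv_into (maximal_fillings D) ((`) route) K') \<in> Tam D"
    if KK': "K \<in> maximal_cliques" "K' \<in> maximal_cliques" for K K'
  proof -
    obtain T T' where T: "T \<in> maximal_fillings D" "T' \<in> maximal_fillings D" "K = route ` T" "K' = route ` T'"
      using KK' maximal_cliques_eq by auto
    then have "(K, K') \<in> framing_lattice \<longleftrightarrow> (T, T') \<in> Tam D"
      using KK' clique_steps_route_iff by (simp add: Tam_def framing_lattice_def)
    then show ?thesis using T by (simp add: inv_into_f_f[OF inj_on_image_route])
  qed
  then show ?thesis
    unfolding iso_iff2 F using bij_betw_inv_into[OF bij] by blast
qed

end

theorem theorem10p2:
  fixes D :: "point set" and L :: grid_labeling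
  assumes "cross_shaped_grid D"
    and "proper_labeling D L"
  shows "\<exists>\<phi>. iso (caracol_framing_lattice D L) (Tam D) \<phi>"
proof -
  interpret labeled_grid D L using assms by (rule labeled_grid.intro)
  show ?thesis unfolding caracol_framing_lattice_def using iso_route by blast
qed

end
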